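(* Let $n$ be a positive integer, let $s\ge 3$ be an integer, let $G$ be the complete bipartite graph $K_{n,n}$, let $\alpha=\left\lfloor \sqrt{2s-2}/2+1\right\rfloor/2$, and let $\mathcal{M}_S$ be a family of at most $\alpha n$ perfect matchings of $G$ (different matchings in the family may share edges). Then there is a perfect matching of $G$ which is $(s-1)$-rainbow and $(2\alpha-1)$-light with respect to $\mathcal{M}_S$.
   Context: A matching $M$ of $G$ is $k$-light with respect to $\mathcal{M}_S$ if no edge of $M$ lies in more than $k$ members of $\mathcal{M}_S$, and $k$-rainbow with respect to $\mathcal{M}_S$ if no member of $\mathcal{M}_S$ contains more than $k$ edges of $M$. *)

theory Defs
  imports Complex_Main
begin

(* A simple graph is a pair (V, E) whose edges are two-element sets of vertices. *)

type_synonym 'v graph = "'v set \<times> 'v set set"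

abbreviation verts :: "'v graph \<Rightarrow> 'v set" where
  "verts G \<equiv> fst G"

abbreviation edges :: "'v graph \<Rightarrow> 'v set set" where
  "edges G \<equiv> snd G"

definition complete_bipartite :: "nat \<Rightarrow> nat \<Rightarrow> (nat + nat) graph" where
  "complete_bipartite m n =
     (Inl ` {..<m} \<union> Inr ` {..<n}, {{Inl i, Inr j} | i j. i < m \<and> j < n})"

definition matching :: "'v graph \<Rightarrow> 'v set set \<Rightarrow> bool" where
  "matching G M \<longleftrightarrow> M \<subseteq> edges G \<and> pairwise disjnt M"

definition perfect_matching :: "'v graph \<Rightarrow> 'v set set \<Rightarrow> bool" where
  "perfect_matching G M \<longleftrightarrow> matching G M \<and> \<Union>M = verts G"

(* A family of matchings is indexed by a finite set I, so members may coincide and are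
   counted with multiplicity. The bound k is real so that it can be a real expression. *)

definition light :: "real \<Rightarrow> 'i set \<Rightarrow> ('i \<Rightarrow> 'v set set) \<Rightarrow> 'v set set \<Rightarrow> bool" where
  "light k I F M \<longleftrightarrow> (\<forall>e\<in>M. real (card {i\<in>I. e \<in> F i}) \<le> k)"

definition rainbow :: "real \<Rightarrow> 'i set \<Rightarrow> ('i \<Rightarrow> 'v set set) \<Rightarrow> 'v set set \<Rightarrow> bool" where
  "rainbow k I F M \<longleftrightarrow> (\<forall>i\<in>I. real (card (F i \<inter> M)) \<le> k)"

end

theory Submission
  imports Defs
begin

text \<open>
  Write \<open>k = 2\<alpha> - 1\<close> and \<open>l = s - 1\<close>, so that \<open>1 \<le> k\<close> and \<open>2k \<le> l\<close>.
  The weight of an edge is the number of members of the family that contain it, so the weights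
  at each vertex add up to the size of the family, which is at most \<open>(k + 1) n / 2\<close>.

  Among the partial matchings that are \<open>k\<close>-light and \<open>l\<close>-rainbow take one, \<open>M\<close>, of maximum size
  and, subject to that, of minimum total weight \<open>W\<close>. Suppose that it misses a row \<open>a\<close> and a column
  \<open>b\<close>. Call a member saturated if it contains \<open>l\<close> edges of \<open>M\<close> and nearly saturated if it contains
  \<open>l - 1\<close>. For \<open>(i, j) \<in> M\<close> an admissible exchange of \<open>(i, j)\<close> for one of \<open>(a, j)\<close>, \<open>(i, b)\<close>
  cannot lower the weight, and the exchange for both cannot be admissible. So \<open>(a, j)\<close> or \<open>(i, b)\<close> is heavy
  or lies in a saturated member, or both lie in a common nearly saturated one. Adding up the
  resulting lower bounds for the weights in row \<open>a\<close> and in column \<open>b\<close>, with \<open>q\<close> saturated and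
  \<open>u\<close> nearly saturated members, gives \<open>W < 2kq + ku \<le> lq + (l - 1)u \<le> W\<close>.
\<close>

section \<open>Edge weights and partial matchings as sets of pairs\<close>

definition multiplicity :: "'i set \<Rightarrow> ('i \<Rightarrow> 'e set) \<Rightarrow> 'e \<Rightarrow> nat" where
  "multiplicity J P e = card {c \<in> J. e \<in> P c}"

lemma multiplicity_pos:
  assumes "finite J" "c \<in> J" "e \<in> P c"
  shows "1 \<le> multiplicity J P e"
  using assms by (auto simp: multiplicity_def Suc_le_eq card_gt_0_iff)

lemma multiplicity_mono:
  assumes "finite J" "K \<subseteq> J"
  shows "multiplicity K P e \<le> multiplicity J P e"
  unfolding multiplicity_def by (rule card_mono) (use assms in auto)

text \<open>Double counting of the pairs of an edge in \<open>E\<close> and a member containing it.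
  With \<open>E\<close> a matching, its total weight becomes the number of its edges summed over the
  members.\<close>

lemma sum_multiplicity:
  assumes "finite E" "finite J"
  shows "(\<Sum>e\<in>E. multiplicity J P e) = (\<Sum>c\<in>J. card (P c \<inter> E))"
  unfolding multiplicity_def
  by (rule sum_multicount_gen) (use assms in \<open>auto intro!: arg_cong[where f = card]\<close>)

lemma card_Int_insert_le:
  "card (S \<inter> insert z N) \<le> card (S \<inter> N) + (if z \<in> S then 1 else 0)"
  by (auto simp: Int_insert_right intro: card_insert_le_m1)

text \<open>The graph is replaced by pairs of a row and a column, and a perfect matching by one pair
  per row and per column, the form that double counting uses directly.\<close>

locale perfect_matching_family =
  fixes A :: "'a set" and B :: "'b set" and I :: "'i set" and P :: "'i \<Rightarrow> ('a \<times> 'b) set"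
    and k l :: nat
  assumes finite_A: "finite A" and finite_B: "finite B" and finite_I: "finite I"
    and card_AB: "card A = card B"
    and row: "\<And>c a. c \<in> I \<Longrightarrow> a \<in> A \<Longrightarrow> card {b \<in> B. (a, b) \<in> P c} = 1"
    and col: "\<And>c b. c \<in> I \<Longrightarrow> b \<in> B \<Longrightarrow> card {a \<in> A. (a, b) \<in> P c} = 1"
    and card_I: "2 * card I \<le> (k + 1) * card A"
    and k_pos: "1 \<le> k" and kl: "2 * k \<le> l"
begin

abbreviation weight :: "'a \<times> 'b \<Rightarrow> nat" where
  "weight \<equiv> multiplicity I P"

definition admissible :: "('a \<times> 'b) set \<Rightarrow> bool" where
  "admissible M \<longleftrightarrow> M \<subseteq> A \<times> B \<and> inj_on fst M \<and> inj_on snd M \<and>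
     (\<forall>e\<in>M. weight e \<le> k) \<and> (\<forall>c\<in>I. card (P c \<inter> M) \<le> l)"

lemma admissible_finite: "admissible M \<Longrightarrow> finite M"
  unfolding admissible_def using finite_A finite_B by (meson finite_SigmaI finite_subset)

text \<open>Each member contributes exactly one pair in row \<open>a\<close>. Allowing a subfamily
  \<open>J\<close> makes the count available for the saturated and nearly saturated members as
  well.\<close>

lemma sum_row:
  assumes "J \<subseteq> I" "a \<in> A"
  shows "(\<Sum>b\<in>B. multiplicity J P (a, b)) = card J"
  unfolding multiplicity_def
  by (subst sum_multicount_gen[where k = "\<lambda>_. 1"])
    (use assms finite_B finite_subset[OF _ finite_I] row in auto)

lemma sum_col:
  assumes "J \<subseteq> I" "b \<in> B"
  shows "(\<Sum>a\<in>A. multiplicity J P (a, b)) = card J"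
  unfolding multiplicity_def
  by (subst sum_multicount_gen[where k = "\<lambda>_. 1"])
    (use assms finite_A finite_subset[OF _ finite_I] col in auto)

text \<open>Only members containing the new pair gain an edge, and they gain just one, so room is
  demanded of those members alone.\<close>

lemma admissible_insert:
  assumes "admissible M" "a \<in> A" "b \<in> B" "a \<notin> fst ` M" "b \<notin> snd ` M" "weight (a, b) \<le> k"
    and "\<And>c. c \<in> I \<Longrightarrow> (a, b) \<in> P c \<Longrightarrow> card (P c \<inter> M) < l"
  shows "admissible (insert (a, b) M)"
proof -
  have "card (P c \<inter> insert (a, b) M) \<le> l" if "c \<in> I" for c
    using card_Int_insert_le[of "P c" "(a, b)" M] assms(1) assms(7)[OF that] that
    by (force simp: admissible_def split: if_splits)
  then show ?thesis
    using assms(1-6) by (auto simp: admissible_def inj_on_insert)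
qed

lemma admissible_remove:
  assumes "admissible M"
  shows "admissible (M - {e})"
proof -
  have "card (P c \<inter> (M - {e})) \<le> card (P c \<inter> M)" for c
    by (rule card_mono) (use admissible_finite[OF assms] in auto)
  then have "card (P c \<inter> (M - {e})) \<le> l" if "c \<in> I" for c
    using assms that le_trans unfolding admissible_def by blast
  then show ?thesis
    using assms by (auto simp: admissible_def intro: inj_on_diff)
qed

section \<open>The extremal partial matching\<close>

lemma admissible_perfect: "\<exists>M. admissible M \<and> card M = card A"
proof -
  have "admissible {}"
    by (simp add: admissible_def)
  moreover have "card M < Suc (card (A \<times> B))" if "admissible M" for M
    using that finite_A finite_B unfolding admissible_def less_Suc_eq_le
    by (meson card_mono finite_SigmaI)
  ultimately obtain N where N: "admissible N" "\<And>M. admissible M \<Longrightarrow> card M \<le> card N"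
    using ex_has_greatest_nat[of admissible "{}" card] by metis
  obtain M where M: "admissible M" "card M = card N"
    and min: "\<And>M'. admissible M' \<Longrightarrow> card M' = card N \<Longrightarrow> sum weight M \<le> sum weight M'"
    using ex_has_least_nat[of "\<lambda>M. admissible M \<and> card M = card N" N "sum weight"] N(1) by blast
  have max: "card M' \<le> card M" if "admissible M'" for M'
    using N(2)[OF that] M(2) by simp
  note finM = admissible_finite[OF M(1)]
  have sub: "M \<subseteq> A \<times> B" and inj: "inj_on fst M" "inj_on snd M"
    and light: "\<And>e. e \<in> M \<Longrightarrow> weight e \<le> k"
    and rainbow: "\<And>c. c \<in> I \<Longrightarrow> card (P c \<inter> M) \<le> l"
    using M(1) by (auto simp: admissible_def)
  have card_fst: "card (fst ` M) = card M" and card_snd: "card (snd ` M) = card M"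
    using inj by (auto simp: card_image)
  have fst_sub: "fst ` M \<subseteq> A" and snd_sub: "snd ` M \<subseteq> B"
    using sub by auto
  have "card M = card A"
  proof (rule ccontr)
    assume "card M \<noteq> card A"
    moreover have "card M \<le> card A"
      using card_mono[OF finite_A fst_sub] card_fst by simp
    ultimately have less: "card M < card A"
      by simp
    define U where "U = B - snd ` M"
    define V where "V = A - fst ` M"
    have cardU: "card U = card A - card M" and cardV: "card V = card A - card M"
      unfolding U_def V_def using card_fst card_snd card_AB fst_sub snd_sub finM
      by (auto simp: card_Diff_subset)
    obtain b where b: "b \<in> U"
      using cardU less by (metis card.empty ex_in_conv zero_less_diff less_irrefl)
    obtain a where a: "a \<in> V"
      using cardV less by (metis card.empty ex_in_conv zero_less_diff less_irrefl)

    define J1 where "J1 = {c \<in> I. card (P c \<inter> M) = l}"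
    define J2 where "J2 = {c \<in> I. card (P c \<inter> M) = l - 1}"
    \<comment> \<open>Disjointness needs \<open>l - 1\<close> to differ from \<open>l\<close> under
      truncated subtraction; this holds because \<open>2 <= 2 * k <= l\<close>.\<close>
    have J: "J1 \<subseteq> I" "J2 \<subseteq> I" "finite J1" "finite J2" "J1 \<inter> J2 = {}"
      using finite_I k_pos kl by (auto simp: J1_def J2_def)
    \<comment> \<open>The penalty \<open>k\<close> per saturated member lifts every obstructed pair
      to at least \<open>k + 1\<close>: a heavy pair reaches it by weight alone, and a pair in a
      saturated member has weight at least 1 plus the penalty. Row and column sums of
      \<open>xi\<close> stay computable.\<close>
    define xi where "xi e = weight e + k * multiplicity J1 P e" for e
    have blocked: "k + 1 \<le> xi e" if "k < weight e \<or> (\<exists>c\<in>J1. e \<in> P c)" for e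
      using that
    proof
      assume "\<exists>c\<in>J1. e \<in> P c"
      then have pos: "1 \<le> multiplicity J1 P e"
        using J(3) multiplicity_pos by metis
      then have "k * 1 \<le> k * multiplicity J1 P e"
        by (rule mult_le_mono2)
      then show ?thesis
        using pos multiplicity_mono[OF finite_I J(1), of P e] unfolding xi_def by linarith
    qed (simp add: xi_def)

    have unblocked: "weight e \<le> k" "\<And>c. c \<in> I \<Longrightarrow> e \<in> P c \<Longrightarrow> card (P c \<inter> M) < l"
      if "\<not> k + 1 \<le> xi e" for e
    proof -
      show "weight e \<le> k"
        using that blocked[of e] by linarith
      show "card (P c \<inter> M) < l" if "c \<in> I" "e \<in> P c" for c
        using \<open>\<not> k + 1 \<le> xi e\<close> blocked[of e] rainbow[OF that(1)] that
        by (auto simp: J1_def order_less_le)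
    qed

    have unmatched: "k + 1 \<le> xi (i, j)" if "i \<in> V" "j \<in> U" for i j
    proof (rule ccontr)
      assume "\<not> k + 1 \<le> xi (i, j)"
      then have "admissible (insert (i, j) M)"
        using that by (intro admissible_insert[OF M(1)] unblocked) (auto simp: U_def V_def)
      moreover have "(i, j) \<notin> M"
        using that by (force simp: U_def)
      ultimately show False
        using max[of "insert (i, j) M"] finM by simp
    qed

    \<comment> \<open>If one of the two pairs is obstructed, it supplies \<open>k + 1\<close> and
      the other supplies \<open>weight (i, j)\<close>. Otherwise a common nearly saturated member
      supplies \<open>k\<close>, \<open>(i, b)\<close> supplies 1, and \<open>(a, j)\<close>
      supplies \<open>weight (i, j)\<close>.\<close>
    have matched: "k + 1 + weight (i, j) \<le> xi (a, j) + xi (i, b) + k * multiplicity J2 P (a, j)"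
      if e: "(i, j) \<in> M" for i j
    proof -
      define N' where "N' = M - {(i, j)}"
      have N': "admissible N'" "finite N'" "card N' = card M - 1" "card M > 0"
        using admissible_remove[OF M(1)] finM e by (auto simp: N'_def card_gt_0_iff)
      have sumN': "sum weight M = weight (i, j) + sum weight N'"
        using finM e by (simp add: N'_def sum.remove)
      have cnt: "card (P c \<inter> N') \<le> card (P c \<inter> M)" for c
        by (rule card_mono) (use finM N'_def in auto)
      have new: "(a, j) \<notin> M" "(i, b) \<notin> M" "a \<in> A" "b \<in> B" "i \<in> A" "j \<in> B" "a \<noteq> i" "b \<noteq> j"
        "a \<notin> fst ` N'" "b \<notin> snd ` N'"
        using a b e sub by (force simp: U_def V_def N'_def)+
      have free: "i \<notin> fst ` N'" "j \<notin> snd ` N'"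
        using e inj by (force simp: N'_def inj_on_def)+
      have exchange: "weight (i, j) \<le> weight z"
        if "admissible (insert z N')" "z \<notin> M" for z
      proof -
        have "z \<notin> N'"
          using that by (simp add: N'_def)
        then show ?thesis
          using min[OF that(1)] N' M(2) sumN' by simp
      qed
      have adm_row: "admissible (insert (a, j) N')" if "\<not> k + 1 \<le> xi (a, j)"
        using new free by (intro admissible_insert N'(1) unblocked le_less_trans[OF cnt]) (use that in auto)
      have adm_col: "admissible (insert (i, b) N')" if "\<not> k + 1 \<le> xi (i, b)"
        using new free by (intro admissible_insert N'(1) unblocked le_less_trans[OF cnt]) (use that in auto)
      \<comment> \<open>Either the exchange is admissible and minimality of the weight applies, or
        \<open>xi\<close> is at least \<open>k + 1\<close>, which exceeds the weight of the light
        pair \<open>(i, j)\<close>.\<close>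
      have ge: "weight (i, j) \<le> xi (a, j)" "weight (i, j) \<le> xi (i, b)"
        using exchange[OF adm_row] exchange[OF adm_col] new light[OF e] unfolding xi_def by force+
      show ?thesis
      proof (cases "k + 1 \<le> xi (a, j) \<or> k + 1 \<le> xi (i, b)")
        case True
        then show ?thesis
          using ge by auto
      next
        case False
        have "\<exists>c\<in>J2. (a, j) \<in> P c \<and> (i, b) \<in> P c"
        proof (rule ccontr)
          assume no: "\<not> ?thesis"
          have "admissible (insert (i, b) (insert (a, j) N'))"
          proof (rule admissible_insert)
            show "admissible (insert (a, j) N')"
              using adm_row False by simp
            show "weight (i, b) \<le> k"
              using False unblocked(1) by blast
            show "i \<notin> fst ` insert (a, j) N'" "b \<notin> snd ` insert (a, j) N'"
              using new free by auto
            fix c assume c: "c \<in> I" "(i, b) \<in> P c"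
            then have "card (P c \<inter> M) < l"
              using False unblocked(2) by blast
            \<comment> \<open>A member containing both new pairs therefore has at most
              \<open>l - 2\<close> edges of \<open>M\<close>, which leaves room for two.\<close>
            moreover have "card (P c \<inter> M) \<noteq> l - 1" if "(a, j) \<in> P c"
              using no that c by (auto simp: J2_def)
            ultimately show "card (P c \<inter> insert (a, j) N') < l"
              using card_Int_insert_le[of "P c" "(a, j)" N'] cnt[of c] by (auto split: if_splits)
          qed (use new in auto)
          moreover have "card (insert (i, b) (insert (a, j) N')) = card M + 1"
            using N' new by (auto simp: N'_def)
          ultimately show False
            using max by fastforce
        qed
        then obtain c where c: "c \<in> J2" "(a, j) \<in> P c" "(i, b) \<in> P c"
          by blast
        then have "1 \<le> multiplicity J2 P (a, j)"
          using J(4) multiplicity_pos by metis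
        then have "k * 1 \<le> k * multiplicity J2 P (a, j)"
          by (rule mult_le_mono2)
        moreover have "1 \<le> weight (a, j)" "1 \<le> weight (i, b)"
          using c J finite_I multiplicity_pos by (metis subsetD)+
        moreover have "weight (i, j) \<le> weight (a, j)"
          using exchange[OF adm_row] False new by simp
        ultimately show ?thesis
          unfolding xi_def by linarith
      qed
    qed

    have split_B: "(\<Sum>j\<in>B. f j) = (\<Sum>e\<in>M. f (snd e)) + (\<Sum>j\<in>U. f j)" for f :: "'b \<Rightarrow> nat"
      using sum.subset_diff[OF snd_sub finite_B, of f] by (simp add: U_def sum.reindex[OF inj(2)])
    have split_A: "(\<Sum>i\<in>A. f i) = (\<Sum>e\<in>M. f (fst e)) + (\<Sum>i\<in>V. f i)" for f :: "'a \<Rightarrow> nat"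
      using sum.subset_diff[OF fst_sub finite_A, of f] by (simp add: V_def sum.reindex[OF inj(1)])
    have aA: "a \<in> A" and bB: "b \<in> B"
      using a b by (auto simp: U_def V_def)
    have row_xi: "(\<Sum>j\<in>B. xi (a, j)) = card I + k * card J1"
      using sum_row[OF subset_refl aA] sum_row[OF J(1) aA]
      by (simp add: xi_def sum.distrib flip: sum_distrib_left)
    have col_xi: "(\<Sum>i\<in>A. xi (i, b)) = card I + k * card J1"
      using sum_col[OF subset_refl bB] sum_col[OF J(1) bB]
      by (simp add: xi_def sum.distrib flip: sum_distrib_left)
    \<comment> \<open>The nearly saturated members are charged in row \<open>a\<close> only, so they
      enter the total once, while the saturated ones enter through both the row and the
      column.\<close>
    have near: "(\<Sum>e\<in>M. multiplicity J2 P (a, snd e)) \<le> card J2"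
      using sum_row[OF J(2) aA] split_B[of "\<lambda>j. multiplicity J2 P (a, j)"] by simp
    have lowU: "(k + 1) * card U \<le> (\<Sum>j\<in>U. xi (a, j))"
      using sum_mono[of U "\<lambda>_. k + 1" "\<lambda>j. xi (a, j)"] unmatched a by (simp add: mult.commute)
    have lowV: "(k + 1) * card V \<le> (\<Sum>i\<in>V. xi (i, b))"
      using sum_mono[of V "\<lambda>_. k + 1" "\<lambda>i. xi (i, b)"] unmatched b by (simp add: mult.commute)
    have "(k + 1) * card M + sum weight M = (\<Sum>e\<in>M. k + 1 + weight e)"
      by (simp add: sum.distrib flip: add_Suc)
    also have "\<dots> \<le> (\<Sum>e\<in>M. xi (a, snd e) + xi (fst e, b) + k * multiplicity J2 P (a, snd e))"
      by (rule sum_mono) (use matched in auto)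
    also have "\<dots> = (\<Sum>e\<in>M. xi (a, snd e)) + (\<Sum>e\<in>M. xi (fst e, b))
        + k * (\<Sum>e\<in>M. multiplicity J2 P (a, snd e))"
      by (simp add: sum.distrib sum_distrib_left)
    also have "\<dots> \<le> (\<Sum>e\<in>M. xi (a, snd e)) + (\<Sum>e\<in>M. xi (fst e, b)) + k * card J2"
      using near by simp
    finally have main: "(k + 1) * card M + sum weight M + (k + 1) * card U + (k + 1) * card V
        \<le> 2 * card I + 2 * (k * card J1) + k * card J2"
      using row_xi col_xi lowU lowV split_B[of "\<lambda>j. xi (a, j)"] split_A[of "\<lambda>i. xi (i, b)"]
      by linarith
    have "card U = card V" "card A = card M + card U" "0 < card U"
      using cardU cardV less by auto
    \<comment> \<open>The unmatched rows and columns together count the deficiency twice, once more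
      than completing \<open>card M\<close> to \<open>card A\<close> requires. This surplus makes
      the next inequality strict.\<close>
    then have "(k + 1) * card A + (k + 1) * card U
        = (k + 1) * card M + (k + 1) * card U + (k + 1) * card V" "0 < (k + 1) * card U"
      by (simp_all add: algebra_simps)
    then have "sum weight M < 2 * (k * card J1) + k * card J2"
      using main card_I by linarith
    also have "\<dots> \<le> l * card J1 + (l - 1) * card J2"
    proof (rule add_mono)
      show "2 * (k * card J1) \<le> l * card J1"
        using mult_le_mono1[OF kl, of "card J1"] by (simp add: mult.assoc)
      show "k * card J2 \<le> (l - 1) * card J2"
        using kl k_pos by (intro mult_le_mono1) linarith
    qed
    \<comment> \<open>The coefficients \<open>l\<close> and \<open>l - 1\<close> are exactly the
      numbers of edges of \<open>M\<close> in these members, so double counting bounds the sum by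
      the total weight of \<open>M\<close>.\<close>
    also have "\<dots> = (\<Sum>c\<in>J1. card (P c \<inter> M)) + (\<Sum>c\<in>J2. card (P c \<inter> M))"
      by (simp add: J1_def J2_def mult.commute)
    also have "\<dots> = (\<Sum>c\<in>J1 \<union> J2. card (P c \<inter> M))"
      using J by (simp add: sum.union_disjoint)
    also have "\<dots> \<le> (\<Sum>c\<in>I. card (P c \<inter> M))"
      using J finite_I by (intro sum_mono2) auto
    also have "\<dots> = sum weight M"
      using sum_multiplicity[OF finM finite_I] by simp
    finally show False
      by simp
  qed
  then show ?thesis
    using M(1) by blast
qed

end

section \<open>Translation between pairs and edges of the complete bipartite graph\<close>

definition edge :: "nat \<times> nat \<Rightarrow> (nat + nat) set" where
  "edge e = {Inl (fst e), Inr (snd e)}"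

lemma edge_eq_iff [simp]: "edge e = edge e' \<longleftrightarrow> e = e'"
  by (auto simp: edge_def doubleton_eq_iff prod_eq_iff)

lemma verts_complete_bipartite:
  "verts (complete_bipartite m n) = Inl ` {..<m} \<union> Inr ` {..<n}"
  by (simp add: complete_bipartite_def)

lemma edges_complete_bipartite:
  "edges (complete_bipartite m n) = edge ` ({..<m} \<times> {..<n})"
  by (force simp: complete_bipartite_def edge_def)

text \<open>Existence comes from covering the vertex \<open>Inl a\<close>, uniqueness from
  disjointness of distinct edges.\<close>

lemma perfect_matching_row:
  assumes F: "perfect_matching (complete_bipartite m n) F" and "a < m"
  shows "card {b \<in> {..<n}. (a, b) \<in> edge -` F} = 1"
proof -
  have "Inl a \<in> \<Union>F"
    using assms by (auto simp: perfect_matching_def verts_complete_bipartite)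
  then obtain e where e: "e \<in> {..<m} \<times> {..<n}" "edge e \<in> F" "Inl a \<in> edge e"
    using F by (auto simp: perfect_matching_def matching_def edges_complete_bipartite)
  then have "e = (a, snd e)"
    by (auto simp: edge_def)
  moreover have "b = b'" if "edge (a, b) \<in> F" "edge (a, b') \<in> F" for b b'
  proof -
    have "\<not> disjnt (edge (a, b)) (edge (a, b'))"
      by (auto simp: edge_def disjnt_def)
    then show ?thesis
      using F that unfolding perfect_matching_def matching_def pairwise_def
      by (metis edge_eq_iff prod.inject)
  qed
  ultimately have "{b \<in> {..<n}. (a, b) \<in> edge -` F} = {snd e}"
    using e by auto
  then show ?thesis
    by simp
qed

lemma perfect_matching_col:
  assumes F: "perfect_matching (complete_bipartite m n) F" and "b < n"
  shows "card {a \<in> {..<m}. (a, b) \<in> edge -` F} = 1"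
proof -
  have "Inr b \<in> \<Union>F"
    using assms by (auto simp: perfect_matching_def verts_complete_bipartite)
  then obtain e where e: "e \<in> {..<m} \<times> {..<n}" "edge e \<in> F" "Inr b \<in> edge e"
    using F by (auto simp: perfect_matching_def matching_def edges_complete_bipartite)
  then have "e = (fst e, b)"
    by (auto simp: edge_def)
  moreover have "a = a'" if "edge (a, b) \<in> F" "edge (a', b) \<in> F" for a a'
  proof -
    have "\<not> disjnt (edge (a, b)) (edge (a', b))"
      by (auto simp: edge_def disjnt_def)
    then show ?thesis
      using F that unfolding perfect_matching_def matching_def pairwise_def
      by (metis edge_eq_iff prod.inject)
  qed
  ultimately have "{a \<in> {..<m}. (a, b) \<in> edge -` F} = {fst e}"
    using e by auto
  then show ?thesis
    by simp
qed

text \<open>Injective projections of a set of size \<open>n\<close> into \<open>{..<n}\<close> are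
  onto, so every vertex is covered; injectivity also makes the edges disjoint.\<close>

lemma perfect_matching_edge_image:
  assumes "M \<subseteq> {..<n} \<times> {..<n}" "inj_on fst M" "inj_on snd M" "card M = n"
  shows "perfect_matching (complete_bipartite n n) (edge ` M)"
proof -
  have "fst ` M = {..<n}" "snd ` M = {..<n}"
    by (rule card_subset_eq; use assms in \<open>auto simp: card_image\<close>)+
  moreover have "\<Union>(edge ` M) = Inl ` fst ` M \<union> Inr ` snd ` M"
    by (force simp: edge_def)
  moreover have "pairwise disjnt (edge ` M)"
    using assms(2,3) by (fastforce simp: pairwise_def disjnt_def edge_def inj_on_def)
  ultimately show ?thesis
    using assms(1)
    by (auto simp: perfect_matching_def matching_def verts_complete_bipartite edges_complete_bipartite)
qed

section \<open>Integer parameters and the return to graphs\<close>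

theorem mainTheorem8:
  fixes n s :: nat and \<alpha> :: real and G :: "(nat + nat) graph"
    and I :: "'i set" and F :: "'i \<Rightarrow> (nat + nat) set set"
  assumes "n > 0" and "s \<ge> 3"
    and "G = complete_bipartite n n"
    and "\<alpha> = real_of_int \<lfloor>sqrt (2 * real s - 2) / 2 + 1\<rfloor> / 2"
    and "finite I" and "real (card I) \<le> \<alpha> * real n"
    and "\<And>i. i \<in> I \<Longrightarrow> perfect_matching G (F i)"
  shows "\<exists>M. perfect_matching G M \<and> rainbow (real s - 1) I F M \<and> light (2 * \<alpha> - 1) I F M"
proof -
  \<comment> \<open>Taking the summand 1 out of the floor gives \<open>2 * \<alpha> = k + 1\<close>.
    Since \<open>s \<ge> 3\<close>, the floor is at least 1 and \<open>nat\<close> loses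
    nothing.\<close>
  define k where "k = nat \<lfloor>sqrt (2 * real s - 2) / 2\<rfloor>"
  have "2 \<le> sqrt (2 * real s - 2)"
    by (rule real_le_rsqrt) (use assms(2) in auto)
  then have floor: "1 \<le> \<lfloor>sqrt (2 * real s - 2) / 2\<rfloor>"
    by (simp add: le_floor_iff)
  then have k: "real k = real_of_int \<lfloor>sqrt (2 * real s - 2) / 2\<rfloor>" and k1: "1 \<le> k"
    unfolding k_def by linarith+
  have \<alpha>: "2 * \<alpha> - 1 = real k"
    using assms(4) k by simp
  \<comment> \<open>Squaring yields \<open>2 * k * k \<le> s - 1\<close>, and
    \<open>k \<le> k * k\<close> then gives the linear bound required of
    \<open>l = s - 1\<close>.\<close>
  have "2 * real k \<le> sqrt (2 * real s - 2)"
    using k by linarith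
  then have "(2 * real k)\<^sup>2 \<le> (sqrt (2 * real s - 2))\<^sup>2"
    by (rule power_mono) simp
  also have "\<dots> = 2 * real s - 2"
    using assms(2) by simp
  finally have "2 * (real k * real k) \<le> real s - 1"
    by (simp add: power2_eq_square)
  moreover have "real k * 1 \<le> real k * real k"
    using k1 by (intro mult_left_mono) auto
  ultimately have kl: "2 * k \<le> s - 1"
    using assms(2) by linarith
  have "2 * real (card I) \<le> 2 * (\<alpha> * real n)"
    using assms(6) by simp
  also have "\<dots> = (real k + 1) * real n"
    using \<alpha> by (simp add: algebra_simps flip: \<alpha>)
  finally have "real (2 * card I) \<le> real ((k + 1) * n)"
    by (simp add: algebra_simps)
  then have card_I: "2 * card I \<le> (k + 1) * n"
    unfolding of_nat_le_iff .
  have "card {b \<in> {..<n}. (a, b) \<in> edge -` F i} = 1" if "i \<in> I" "a \<in> {..<n}" for i a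
    using that assms(3,7) by (intro perfect_matching_row) auto
  moreover have "card {a \<in> {..<n}. (a, b) \<in> edge -` F i} = 1" if "i \<in> I" "b \<in> {..<n}" for i b
    using that assms(3,7) by (intro perfect_matching_col) auto
  ultimately interpret perfect_matching_family "{..<n}" "{..<n}" I "\<lambda>i. edge -` F i" k "s - 1"
    using assms(5) k1 kl card_I by unfold_locales auto
  obtain M where M: "admissible M" "card M = n"
    using admissible_perfect by auto
  have "perfect_matching G (edge ` M)"
    using M unfolding assms(3) admissible_def by (intro perfect_matching_edge_image) auto
  moreover have "light (2 * \<alpha> - 1) I F (edge ` M)"
    using M(1) unfolding light_def \<alpha> admissible_def multiplicity_def by simp
  moreover have "rainbow (real s - 1) I F (edge ` M)"
    unfolding rainbow_def
  proof
    fix i assume "i \<in> I"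
    have "F i \<inter> edge ` M = edge ` (edge -` F i \<inter> M)"
      by auto
    then have "card (F i \<inter> edge ` M) \<le> card (edge -` F i \<inter> M)"
      using admissible_finite[OF M(1)] by (simp add: card_image_le)
    also have "\<dots> \<le> s - 1"
      using M(1) \<open>i \<in> I\<close> unfolding admissible_def by blast
    finally show "real (card (F i \<inter> edge ` M)) \<le> real s - 1"
      using assms(2) by linarith
  qed
  ultimately show ?thesis
    by blast
qed

end
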